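(* Let $(X,\mathcal A,m)$ and $(\Omega,\mathcal F,\mathbb P)$ be probability spaces, let $\sigma:\Omega\to\Omega$ be a $\mathbb P$-preserving transformation, and let $(P,\sigma)$ be an asymptotically periodic Markov operator cocycle over $\sigma$ acting on $L^1(X,m)$, with data $r$, $\lambda_i$, $\varphi_i$ $(1\le i\le r)$ and $\rho_\omega$ as in the definition of asymptotic periodicity, such that the permutation $\rho_\omega\equiv\rho$ is constant $\mathbb P$-almost everywhere. Then $(P,\sigma)$ admits an invariant density map, and there exists a natural number $k$ such that $(P^{(k)}|_{\operatorname{supp}\varphi_i},\sigma^k)$ is exact for $i=1,\dots,r$.
   Context: A Markov operator on $L^1(X,m)$ is a linear positive operator preserving the integral $\int_X\cdot\,dm$. A Markov operator cocycle $(P,\sigma)$ is given by a measurable map $P:\Omega\times L^1(X,m)\to L^1(X,m)$ such that $P_\omega=P(\omega,\cdot)$ is a Markov operator for $\mathbb P$-almost every $\omega$; set $P^{(n)}_\omega=P_{\sigma^{n-1}\omega}\circ\cdots\circ P_{\sigma\omega}\circ P_\omega$. $D(X,m)=\{f\in L^1(X,m):f\ge 0\ m\text{-a.e.},\ \|f\|_{L^1(X)}=1\}$. $B(\Omega,E)$ denotes the set of all bounded measurable maps from $\Omega$ to $E$; $(L^1(X,m))'$ is the dual space. An invariant density map for $(P,\sigma)$ is a measurable map $h:\Omega\to D(X,m)$, $\omega\mapsto h_\omega$, with $P_\omega h_\omega=h_{\sigma\omega}$ for $\mathbb P$-almost every $\omega$. Asymptotic periodicity: there exist an integer $r\geq 1$,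 $\{\lambda_i\}_{i=1}^r\subset B(\Omega,(L^1(X,m))')$ and $\{\varphi_i\}_{i=1}^r\subset B(\Omega,D(X,m))$ (written $\lambda_i^\omega=\lambda_i(\omega)$, $\varphi_i^\omega=\varphi_i(\omega)$) such that for $\mathbb P$-almost every $\omega$ the densities $\varphi_1^\omega,\dots,\varphi_r^\omega$ have mutually disjoint supports, and there exists a permutation $\rho_\omega$ of $\{1,\dots,r\}$ such that $$P_\omega\varphi_i^\omega=\varphi^{\sigma\omega}_{\rho_\omega(i)}\quad\text{and}\quad\lim_{n\to\infty}\Bigl\|P^{(n)}_\omega\Bigl(f-\sum_{i=1}^r\lambda_i^\omega(f)\varphi_i^\omega\Bigr)\Bigr\|_{L^1(X)}=0$$ for every $f\in L^1(X,m)$, $1\le i\le r$ and $\mathbb P$-almost every $\omega$. $P^{(k)}|_{\operatorname{supp}\varphi_i}$ denotes the map $\omega\mapsto P^{(k)}_\omega|_{\operatorname{supp}\varphi_i^\omega}$, where $P^{(k)}_\omega|_{\operatorname{supp}\varphi_i^\omega}$ is the restriction of $P^{(k)}_\omega$ to $L^1(\operatorname{supp}\varphi_i^\omega,m)$ (functions in $L^1(X,m)$ vanishing outside $\operatorname{supp}\varphi_i^\omega$), regarded as a Markov operator from $L^1(\operatorname{supp}\varphi_i^\omega,m)$ to $L^1(\operatorname{supp}\varphi_i^{\sigma^k\omega},m)$. Exactness of $(P^{(k)}|_{\operatorname{supp}\varphi_i},\sigma^k)$ means: for $\mathbb P$-almost every $\omega$ and every $f\in L^1(\operatorname{supp}\varphi_i^\omega,m)$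 with $\int_X f\,dm=0$, $\lim_{n\to\infty}\|P^{(nk)}_\omega f\|_{L^1(X)}=0$.
   Formalization: Measurability of the maps φ_i and h into D(X,m) is taken as strong (Borel and almost everywhere separably valued), automatic if L^1(X,m) is separable; for non-separable L^1 Borel measurability alone can fail to give a measurable invariant density if measurable cardinals exist. *)

theory Defs
  imports "HOL-Probability.Probability" "HOL-Combinatorics.Permutations"
begin

text \<open>
  Elements of \<open>L\<^sup>1(X,m)\<close> are represented by integrable functions, and every equation,
  inequality or vanishing condition between them is meant almost everywhere.
\<close>

subsection \<open>Function spaces\<close>

definition L1 :: "'x measure \<Rightarrow> ('x \<Rightarrow> real) set" where
  "L1 m = {f. integrable m f}"

definition L1_norm :: "'x measure \<Rightarrow> ('x \<Rightarrow> real) \<Rightarrow> real" where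
  "L1_norm m f = (\<integral>x. \<bar>f x\<bar> \<partial>m)"

definition L1_on :: "'x measure \<Rightarrow> 'x set \<Rightarrow> ('x \<Rightarrow> real) set" where
  "L1_on m A = {f \<in> L1 m. AE x in m. x \<notin> A \<longrightarrow> f x = 0}"

definition L1_densities :: "'x measure \<Rightarrow> ('x \<Rightarrow> real) set" where
  "L1_densities m = {f \<in> L1 m. (AE x in m. 0 \<le> f x) \<and> L1_norm m f = 1}"

definition supp :: "'x measure \<Rightarrow> ('x \<Rightarrow> real) \<Rightarrow> 'x set" where
  "supp m f = {x \<in> space m. f x \<noteq> 0}"

text \<open>
  The dual of \<open>L\<^sup>1(X,m)\<close>. The bound forces a functional to agree on functions that are equal almost
  everywhere; its values outside \<^term>\<open>L1 m\<close> are irrelevant, and \<open>dual_norm\<close> ignores them.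
\<close>

definition L1_dual :: "'x measure \<Rightarrow> (('x \<Rightarrow> real) \<Rightarrow> real) set" where
  "L1_dual m = {l.
     (\<forall>f\<in>L1 m. \<forall>g\<in>L1 m. \<forall>a b. l (\<lambda>x. a * f x + b * g x) = a * l f + b * l g) \<and>
     (\<exists>C. \<forall>f\<in>L1 m. \<bar>l f\<bar> \<le> C * L1_norm m f)}"

definition dual_norm :: "'x measure \<Rightarrow> (('x \<Rightarrow> real) \<Rightarrow> real) \<Rightarrow> real" where
  "dual_norm m l = (SUP f\<in>{f \<in> L1 m. L1_norm m f \<le> 1}. \<bar>l f\<bar>)"


subsection \<open>Measurable maps into function spaces\<close>

text \<open>
  The Borel sigma-algebra of a set \<open>E\<close> of functions under the distance \<open>N (u - v)\<close>, for a seminorm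
  \<open>N\<close>. Open sets are unions of classes of functions at distance 0, so this is the Borel
  sigma-algebra of the associated normed quotient. In particular, maps that are measurable into
  \<open>norm_borel (L1 m) (L1_norm m)\<close> from a space carrying this sigma-algebra respect equality almost
  everywhere.
\<close>

definition norm_borel :: "('b \<Rightarrow> real) set \<Rightarrow> (('b \<Rightarrow> real) \<Rightarrow> real) \<Rightarrow> ('b \<Rightarrow> real) measure" where
  "norm_borel E N = sigma E {U. U \<subseteq> E \<and>
     (\<forall>u\<in>U. \<exists>e>0. \<forall>v\<in>E. N (\<lambda>x. v x - u x) < e \<longrightarrow> v \<in> U)}"

definition bounded_measurable ::
  "'w measure \<Rightarrow> ('b \<Rightarrow> real) set \<Rightarrow> (('b \<Rightarrow> real) \<Rightarrow> real) \<Rightarrow> ('w \<Rightarrow> 'b \<Rightarrow> real) set" where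
  "bounded_measurable Om E N =
     {g \<in> Om \<rightarrow>\<^sub>M norm_borel E N. \<exists>C. \<forall>\<omega>\<in>space Om. N (g \<omega>) \<le> C}"

definition almost_separably_valued ::
  "'w measure \<Rightarrow> ('b \<Rightarrow> real) set \<Rightarrow> (('b \<Rightarrow> real) \<Rightarrow> real) \<Rightarrow> ('w \<Rightarrow> 'b \<Rightarrow> real) \<Rightarrow> bool" where
  "almost_separably_valued Om E N g \<longleftrightarrow>
     (\<exists>C. countable C \<and> C \<subseteq> E \<and>
        (AE \<omega> in Om. \<forall>e>0. \<exists>c\<in>C. N (\<lambda>x. g \<omega> x - c x) < e))"

text \<open>
  Measurable maps into the set of densities, in Bochner's sense: Borel measurable and almost
  separably valued. The second condition holds automatically if \<open>L\<^sup>1(X,m)\<close> is separable. It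
  matters only for non-separable \<open>L\<^sup>1(X,m)\<close>, where sums of Borel measurable maps need not be Borel
  measurable. Boundedness is automatic, since densities have norm 1.
\<close>

definition density_map :: "'w measure \<Rightarrow> 'x measure \<Rightarrow> ('w \<Rightarrow> 'x \<Rightarrow> real) \<Rightarrow> bool" where
  "density_map Om m g \<longleftrightarrow>
     g \<in> bounded_measurable Om (L1_densities m) (L1_norm m) \<and>
     almost_separably_valued Om (L1_densities m) (L1_norm m) g"


subsection \<open>Markov operator cocycles\<close>

definition measure_preserving_map :: "'w measure \<Rightarrow> ('w \<Rightarrow> 'w) \<Rightarrow> bool" where
  "measure_preserving_map Om \<sigma> \<longleftrightarrow> \<sigma> \<in> Om \<rightarrow>\<^sub>M Om \<and> distr Om Om \<sigma> = Om"

definition markov_operator ::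
  "'x measure \<Rightarrow> ('x \<Rightarrow> real) set \<Rightarrow> ('x \<Rightarrow> real) set \<Rightarrow> (('x \<Rightarrow> real) \<Rightarrow> 'x \<Rightarrow> real) \<Rightarrow> bool" where
  "markov_operator m E F T \<longleftrightarrow>
     (\<forall>f\<in>E. T f \<in> F) \<and>
     (\<forall>f\<in>E. \<forall>g\<in>E. \<forall>a b. AE x in m. T (\<lambda>y. a * f y + b * g y) x = a * T f x + b * T g x) \<and>
     (\<forall>f\<in>E. (AE x in m. 0 \<le> f x) \<longrightarrow> (AE x in m. 0 \<le> T f x)) \<and>
     (\<forall>f\<in>E. (\<integral>x. T f x \<partial>m) = (\<integral>x. f x \<partial>m))"

definition markov_cocycle ::
  "'w measure \<Rightarrow> 'x measure \<Rightarrow> ('w \<Rightarrow> ('x \<Rightarrow> real) \<Rightarrow> 'x \<Rightarrow> real) \<Rightarrow> bool" where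
  "markov_cocycle Om m P \<longleftrightarrow>
     (\<lambda>(\<omega>, f). P \<omega> f) \<in> Om \<Otimes>\<^sub>M norm_borel (L1 m) (L1_norm m) \<rightarrow>\<^sub>M norm_borel (L1 m) (L1_norm m) \<and>
     (AE \<omega> in Om. markov_operator m (L1 m) (L1 m) (P \<omega>))"

primrec cocycle_iter ::
  "('w \<Rightarrow> ('x \<Rightarrow> real) \<Rightarrow> 'x \<Rightarrow> real) \<Rightarrow> ('w \<Rightarrow> 'w) \<Rightarrow> nat \<Rightarrow> 'w \<Rightarrow> ('x \<Rightarrow> real) \<Rightarrow> 'x \<Rightarrow> real" where
  "cocycle_iter P \<sigma> 0 \<omega> f = f"
| "cocycle_iter P \<sigma> (Suc n) \<omega> f = P ((\<sigma> ^^ n) \<omega>) (cocycle_iter P \<sigma> n \<omega> f)"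

definition invariant_density_map ::
  "'w measure \<Rightarrow> 'x measure \<Rightarrow> ('w \<Rightarrow> 'w) \<Rightarrow> ('w \<Rightarrow> ('x \<Rightarrow> real) \<Rightarrow> 'x \<Rightarrow> real) \<Rightarrow>
   ('w \<Rightarrow> 'x \<Rightarrow> real) \<Rightarrow> bool" where
  "invariant_density_map Om m \<sigma> P h \<longleftrightarrow>
     density_map Om m h \<and> (AE \<omega> in Om. AE x in m. P \<omega> (h \<omega>) x = h (\<sigma> \<omega>) x)"

definition asymptotically_periodic ::
  "'w measure \<Rightarrow> 'x measure \<Rightarrow> ('w \<Rightarrow> 'w) \<Rightarrow> ('w \<Rightarrow> ('x \<Rightarrow> real) \<Rightarrow> 'x \<Rightarrow> real) \<Rightarrow> nat \<Rightarrow>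
   (nat \<Rightarrow> 'w \<Rightarrow> ('x \<Rightarrow> real) \<Rightarrow> real) \<Rightarrow> (nat \<Rightarrow> 'w \<Rightarrow> 'x \<Rightarrow> real) \<Rightarrow> ('w \<Rightarrow> nat \<Rightarrow> nat) \<Rightarrow> bool" where
  "asymptotically_periodic Om m \<sigma> P r lam \<phi> \<rho> \<longleftrightarrow>
     1 \<le> r \<and>
     (\<forall>i\<in>{1..r}. lam i \<in> bounded_measurable Om (L1_dual m) (dual_norm m)) \<and>
     (\<forall>i\<in>{1..r}. density_map Om m (\<phi> i)) \<and>
     (AE \<omega> in Om.
        (\<forall>i\<in>{1..r}. \<forall>j\<in>{1..r}. i \<noteq> j \<longrightarrow> (AE x in m. x \<notin> supp m (\<phi> i \<omega>) \<inter> supp m (\<phi> j \<omega>))) \<and>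
        \<rho> \<omega> permutes {1..r} \<and>
        (\<forall>i\<in>{1..r}. AE x in m. P \<omega> (\<phi> i \<omega>) x = \<phi> (\<rho> \<omega> i) (\<sigma> \<omega>) x) \<and>
        (\<forall>f\<in>L1 m.
           (\<lambda>n. L1_norm m (cocycle_iter P \<sigma> n \<omega> (\<lambda>x. f x - (\<Sum>i=1..r. lam i \<omega> f * \<phi> i \<omega> x))))
             \<longlonglongrightarrow> 0))"

text \<open>
  Exactness of the cocycle \<open>P\<^bsup>(k)\<^esup>\<close> restricted to \<open>supp \<phi>\<close>, over \<open>\<sigma>\<^sup>k\<close>. The first clause says that
  the restriction is a Markov operator between the \<open>L\<^sup>1\<close> spaces over the supports at \<open>\<omega>\<close> and at
  \<open>\<sigma>\<^sup>k \<omega>\<close>, so that the restricted cocycle is well defined; its \<open>n\<close>-th iterate is \<open>P\<^bsup>(nk)\<^esup>\<close>.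
\<close>

definition restriction_exact ::
  "'w measure \<Rightarrow> 'x measure \<Rightarrow> ('w \<Rightarrow> 'w) \<Rightarrow> ('w \<Rightarrow> ('x \<Rightarrow> real) \<Rightarrow> 'x \<Rightarrow> real) \<Rightarrow> nat \<Rightarrow>
   ('w \<Rightarrow> 'x \<Rightarrow> real) \<Rightarrow> bool" where
  "restriction_exact Om m \<sigma> P k \<phi> \<longleftrightarrow>
     (AE \<omega> in Om. markov_operator m
        (L1_on m (supp m (\<phi> \<omega>))) (L1_on m (supp m (\<phi> ((\<sigma> ^^ k) \<omega>)))) (cocycle_iter P \<sigma> k \<omega>)) \<and>
     (AE \<omega> in Om. \<forall>f\<in>L1_on m (supp m (\<phi> \<omega>)). (\<integral>x. f x \<partial>m) = 0 \<longrightarrow>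
        (\<lambda>n. L1_norm m (cocycle_iter P \<sigma> (n * k) \<omega> f)) \<longlonglongrightarrow> 0)"

end

theory Submission
  imports Defs "HOL-Combinatorics.Cycles"
begin

text \<open>
  Since \<open>\<rho>\<close> is constant, \<open>P\<^sub>\<omega>\<close> only permutes the \<open>\<phi>\<^sub>i\<close>, so their average is invariant. Let \<open>\<rho>\<^sup>k = id\<close>.
  A Markov operator \<open>T\<close> maps functions supported on \<open>supp \<phi>\<close> to functions supported on
  \<open>supp (T \<phi>)\<close>, so \<open>P\<^bsup>(k)\<^esup>\<close> restricts to the supports. If \<open>f\<close> lives on \<open>supp \<phi>\<^sub>i\<close> and has integral 0,
  then \<open>P\<^bsup>(nk)\<^esup> f\<close> vanishes on \<open>supp \<phi>\<^sub>j\<close> for \<open>j \<noteq> i\<close>, whence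
  \<open>\<bar>\<lambda>\<^sub>j f\<bar> \<le> \<parallel>P\<^bsup>(nk)\<^esup> (f - \<Sum>\<^sub>l \<lambda>\<^sub>l f \<cdot> \<phi>\<^sub>l)\<parallel> \<rightarrow> 0\<close>; comparing integrals, also \<open>\<lambda>\<^sub>i f = 0\<close>, so asymptotic
  periodicity gives \<open>P\<^bsup>(nk)\<^esup> f \<rightarrow> 0\<close>.
\<close>

section \<open>Markov operators modulo null sets, and how they move supports\<close>

subsection \<open>Markov operators\<close>

lemma markov_operatorD:
  assumes "markov_operator m E F T" "f \<in> E"
  shows markov_operator_mem: "T f \<in> F"
    and markov_operator_nonneg: "(AE x in m. 0 \<le> f x) \<Longrightarrow> (AE x in m. 0 \<le> T f x)"
    and markov_operator_integral: "(\<integral>x. T f x \<partial>m) = (\<integral>x. f x \<partial>m)"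
    and markov_operator_linear: "g \<in> E \<Longrightarrow>
      AE x in m. T (\<lambda>y. a * f y + b * g y) x = a * T f x + b * T g x"
  using assms unfolding markov_operator_def by blast+

lemma L1_lincomb: "f \<in> L1 m \<Longrightarrow> g \<in> L1 m \<Longrightarrow> (\<lambda>x. a * f x + b * g x) \<in> L1 m"
  by (auto simp: L1_def)

lemma L1_sum: "(\<And>i. i \<in> A \<Longrightarrow> g i \<in> L1 m) \<Longrightarrow> (\<lambda>x. \<Sum>i\<in>A. c i * g i x) \<in> L1 m"
  by (auto simp: L1_def)

text \<open>Operators act here on representatives, so that they descend to classes has to be
  derived. The difference \<open>d\<close> is null, so positivity makes \<open>T d\<close>
  nonnegative, and a nonnegative function with integral 0 is null.\<close>

lemma markov_operator_cong_AE:
  assumes T: "markov_operator m (L1 m) (L1 m) T" and fg: "f \<in> L1 m" "g \<in> L1 m"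
    and eq: "AE x in m. f x = g x"
  shows "AE x in m. T f x = T g x"
proof -
  define d where "d = (\<lambda>x. 1 * f x + (- 1) * g x)"
  have d: "d \<in> L1 m" unfolding d_def by (rule L1_lincomb[OF fg])
  have d0: "AE x in m. d x = 0" using eq by eventually_elim (simp add: d_def)
  have nn: "AE x in m. 0 \<le> T d x"
    by (rule markov_operator_nonneg[OF T d]) (use d0 in eventually_elim, simp)
  have "(\<integral>x. T d x \<partial>m) = (\<integral>x. d x \<partial>m)" by (rule markov_operator_integral[OF T d])
  also have "\<dots> = (\<integral>x. 0 \<partial>m)"
    by (rule integral_cong_AE) (use d d0 in \<open>auto simp: L1_def\<close>)
  finally have "AE x in m. T d x = 0"
    using integral_nonneg_eq_0_iff_AE[OF _ nn] markov_operator_mem[OF T d] by (auto simp: L1_def)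
  with markov_operator_linear[OF T fg, of 1 "- 1"] show ?thesis
    unfolding d_def by eventually_elim simp
qed

lemma markov_operator_sum:
  assumes T: "markov_operator m (L1 m) (L1 m) T" and "finite A"
    and "\<And>i. i \<in> A \<Longrightarrow> g i \<in> L1 m"
  shows "AE x in m. T (\<lambda>y. \<Sum>i\<in>A. c i * g i y) x = (\<Sum>i\<in>A. c i * T (g i) x)"
  using assms(2,3)
proof (induction A rule: finite_induct)
  case empty
  \<comment> \<open>Linearity with both coefficients 0 gives \<open>T 0 = 0\<close> almost
    everywhere, which is the empty sum.\<close>
  have z: "(\<lambda>y. 0) \<in> L1 m" by (simp add: L1_def)
  show ?case using markov_operator_linear[OF T z z, of 0 0] by simp
next
  case (insert j A)
  have 1: "g j \<in> L1 m" and 2: "(\<lambda>y. \<Sum>i\<in>A. c i * g i y) \<in> L1 m"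
    using insert.prems by (auto intro: L1_sum)
  have "AE x in m. T (\<lambda>y. \<Sum>i\<in>A. c i * g i y) x = (\<Sum>i\<in>A. c i * T (g i) x)"
    using insert by auto
  with markov_operator_linear[OF T 1 2, of "c j" 1] show ?case
    by eventually_elim (use insert.hyps in simp)
qed

text \<open>Truncate \<open>f\<close> at height \<open>n * p\<close>. The truncation
  \<open>g n\<close> has an image dominated by \<open>n * T p\<close>, so that image contributes
  nothing positive off the support of \<open>T p\<close>. The remainder \<open>d n\<close> has
  integral tending to 0, and \<open>T\<close> preserves this integral.\<close>

lemma markov_operator_vanish_nonneg:
  assumes T: "markov_operator m (L1 m) (L1 m) T" and p: "p \<in> L1 m" "AE x in m. 0 \<le> p x"
    and f: "f \<in> L1_on m (supp m p)" "AE x in m. 0 \<le> f x"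
  shows "AE x in m. x \<notin> supp m (T p) \<longrightarrow> T f x = 0"
proof -
  have fL: "f \<in> L1 m" and f0: "AE x in m. x \<notin> supp m p \<longrightarrow> f x = 0"
    using f(1) by (auto simp: L1_on_def)
  have fp: "integrable m f" "integrable m p" using fL p by (auto simp: L1_def)
  define g where "g n = (\<lambda>x. min (f x) (real n * p x))" for n
  define d where "d n = (\<lambda>x. f x - g n x)" for n
  have gL: "g n \<in> L1 m" for n
    unfolding g_def L1_def using fp by (auto intro!: integrable_min)
  have dL: "d n \<in> L1 m" for n
    using fL gL[of n] by (auto simp: d_def L1_def)
  have d_bound: "AE x in m. 0 \<le> d n x \<and> d n x \<le> f x" for n
    using f(2) p(2) by eventually_elim (auto simp: d_def g_def min_def)
  have d_lim: "(\<lambda>n. \<integral>x. d n x \<partial>m) \<longlonglongrightarrow> (\<integral>x. 0 \<partial>m)"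
  proof (rule integral_dominated_convergence[where w = f])
    \<comment> \<open>Where \<open>p\<close> is 0, so is \<open>f\<close>, and every
      \<open>d n\<close> vanishes; where \<open>p\<close> is positive, \<open>n * p\<close>
      eventually exceeds \<open>f\<close>. So \<open>d n x\<close> is eventually 0.\<close>
    show "AE x in m. (\<lambda>n. d n x) \<longlonglongrightarrow> 0"
      using f(2) p(2) f0 AE_space
    proof eventually_elim
      case (elim x)
      show ?case
      proof (cases "p x = 0")
        case True
        with elim have "f x = 0" by (auto simp: supp_def)
        with True show ?thesis by (simp add: d_def g_def)
      next
        case False
        with elim have "p x > 0" by simp
        then obtain N :: nat where N: "f x < real N * p x" using reals_Archimedean3 by blast
        have "d n x = 0" if "n \<ge> N" for n
        proof -
          have "real N * p x \<le> real n * p x" using that \<open>p x > 0\<close> by simp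
          with N show ?thesis by (simp add: d_def g_def)
        qed
        then show ?thesis
          by (intro tendsto_eventually) (auto simp: eventually_sequentially)
      qed
    qed
  next
    fix n show "AE x in m. norm (d n x) \<le> f x"
      using d_bound[of n] by eventually_elim auto
  qed (use dL fp in \<open>auto simp: L1_def\<close>)
  define B where "B = space m - supp m (T p)"
  have [measurable]: "integrable m (T p)" "integrable m (T f)" "integrable m (T (d n))" for n
    using markov_operator_mem[OF T] p fL dL by (auto simp: L1_def)
  have [measurable]: "T p \<in> borel_measurable m" by (rule borel_measurable_integrable) fact
  have B[measurable]: "B \<in> sets m"
    unfolding B_def supp_def by measurable
  have int: "integrable m (\<lambda>x. indicator B x * T f x)"
    using integrable_real_mult_indicator[OF B \<open>integrable m (T f)\<close>] by (simp add: mult.commute)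
  have le: "(\<integral>x. indicator B x * T f x \<partial>m) \<le> (\<integral>x. d n x \<partial>m)" for n
  proof -
    have e: "(\<lambda>x. 1 * g n x + 1 * d n x) = f" by (auto simp: d_def)
    \<comment> \<open>Positivity on \<open>n * p - g n\<close> gives
      \<open>T (g n) \<le> n * T p\<close>. On \<open>B\<close> the right side is 0, hence
      \<open>T f \<le> T (d n)\<close> there; off \<open>B\<close> the claim is
      \<open>0 \<le> T (d n)\<close>.\<close>
    have q: "(\<lambda>x. real n * p x + (- 1) * g n x) \<in> L1 m" by (rule L1_lincomb[OF p(1) gL])
    have "AE x in m. 0 \<le> T (\<lambda>x. real n * p x + (- 1) * g n x) x"
      by (rule markov_operator_nonneg[OF T q]) (simp add: g_def)
    moreover have "AE x in m. T f x = 1 * T (g n) x + 1 * T (d n) x"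
      using markov_operator_linear[OF T gL[of n] dL[of n], of 1 1] unfolding e by simp
    moreover have "AE x in m. 0 \<le> T (d n) x"
      by (rule markov_operator_nonneg[OF T dL]) (use d_bound[of n] in eventually_elim, simp)
    ultimately have "AE x in m. indicator B x * T f x \<le> T (d n) x"
      using markov_operator_linear[OF T p(1) gL[of n], of "real n" "- 1"] AE_space
      by eventually_elim (auto simp: indicator_def B_def supp_def)
    then have "(\<integral>x. indicator B x * T f x \<partial>m) \<le> (\<integral>x. T (d n) x \<partial>m)"
      using int \<open>integrable m (T (d n))\<close> by (intro integral_mono_AE)
    then show ?thesis using markov_operator_integral[OF T dL] by simp
  qed
  have nn: "AE x in m. 0 \<le> indicator B x * T f x"
    using markov_operator_nonneg[OF T fL f(2)] by eventually_elim simp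
  have "(\<integral>x. indicator B x * T f x \<partial>m) \<le> (\<integral>x. 0 \<partial>m)"
    using LIMSEQ_le_const[OF d_lim] le by blast
  moreover have "(\<integral>x. indicator B x * T f x \<partial>m) \<ge> 0"
    by (rule integral_nonneg_AE[OF nn])
  ultimately have "AE x in m. indicator B x * T f x = 0"
    using integral_nonneg_eq_0_iff_AE[OF int nn] by simp
  then show ?thesis using AE_space
    by eventually_elim (auto simp: B_def indicator_def)
qed

text \<open>The positive and negative parts of \<open>f\<close> also vanish off
  \<open>supp m p\<close>, so linearity reduces to the nonnegative case.\<close>

lemma markov_operator_vanish:
  assumes T: "markov_operator m (L1 m) (L1 m) T" and p: "p \<in> L1 m" "AE x in m. 0 \<le> p x"
    and f: "f \<in> L1_on m (supp m p)"
  shows "AE x in m. x \<notin> supp m (T p) \<longrightarrow> T f x = 0"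
proof -
  define u where "u = (\<lambda>x. max (f x) 0)"
  define v where "v = (\<lambda>x. max (- f x) 0)"
  have fL: "integrable m f" and f0: "AE x in m. x \<notin> supp m p \<longrightarrow> f x = 0"
    using f by (auto simp: L1_on_def L1_def)
  have uv: "u \<in> L1 m" "v \<in> L1 m"
    using fL by (auto simp: L1_def u_def v_def intro!: integrable_max)
  have u: "u \<in> L1_on m (supp m p)" unfolding L1_on_def
    using uv f0 by (auto simp: u_def elim!: eventually_mono)
  have v: "v \<in> L1_on m (supp m p)" unfolding L1_on_def
    using uv f0 by (auto simp: v_def elim!: eventually_mono)
  have e: "(\<lambda>x. 1 * u x + (- 1) * v x) = f" by (auto simp: u_def v_def max_def)
  have "AE x in m. x \<notin> supp m (T p) \<longrightarrow> T u x = 0"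
    by (rule markov_operator_vanish_nonneg[OF T p u]) (simp add: u_def)
  moreover have "AE x in m. x \<notin> supp m (T p) \<longrightarrow> T v x = 0"
    by (rule markov_operator_vanish_nonneg[OF T p v]) (simp add: v_def)
  moreover have "AE x in m. T f x = 1 * T u x + (- 1) * T v x"
    using markov_operator_linear[OF T uv, of 1 "- 1"] unfolding e .
  ultimately show ?thesis by eventually_elim auto
qed

text \<open>The target is the support of a representative \<open>q\<close> of \<open>T p\<close>,
  because the image of a density under the cocycle is known only up to a null set.\<close>

lemma markov_operator_restrict:
  assumes T: "markov_operator m (L1 m) (L1 m) T" and p: "p \<in> L1 m" "AE x in m. 0 \<le> p x"
    and q: "AE x in m. T p x = q x"
  shows "markov_operator m (L1_on m (supp m p)) (L1_on m (supp m q)) T"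
proof -
  have "T f \<in> L1_on m (supp m q)" if f: "f \<in> L1_on m (supp m p)" for f
  proof -
    have "AE x in m. x \<notin> supp m q \<longrightarrow> T f x = 0"
      using markov_operator_vanish[OF T p f] q by eventually_elim (auto simp: supp_def)
    moreover have "T f \<in> L1 m" using f markov_operator_mem[OF T] by (auto simp: L1_on_def)
    ultimately show ?thesis by (simp add: L1_on_def)
  qed
  moreover have "L1_on m (supp m p) \<subseteq> L1 m" by (auto simp: L1_on_def)
  ultimately show ?thesis using T unfolding markov_operator_def by (meson subsetD)
qed

text \<open>On the support of \<open>T (p j)\<close> with \<open>j \<noteq> i\<close>, both
  \<open>T f\<close> and all other images vanish, so \<open>T\<close> of the difference is
  \<open>- c j * T (p j)\<close> there, and \<open>T (p j)\<close> has integral 1. The bound on the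
  sum compares total integrals. The operator is fixed and the coefficients are arbitrary, so that
  the bounds can be used for each iterate before passing to the limit.\<close>

lemma markov_operator_coeff_bounds:
  fixes c :: "'i \<Rightarrow> real"
  assumes T: "markov_operator m (L1 m) (L1 m) T" and "finite I"
    and p: "\<And>j. j \<in> I \<Longrightarrow> p j \<in> L1_densities m"
    and disj: "\<And>j l. j \<in> I \<Longrightarrow> l \<in> I \<Longrightarrow> j \<noteq> l \<Longrightarrow> AE x in m. T (p j) x = 0 \<or> T (p l) x = 0"
    and i: "i \<in> I" and f: "f \<in> L1_on m (supp m (p i))" and f0: "(\<integral>x. f x \<partial>m) = 0"
  defines "N \<equiv> L1_norm m (T (\<lambda>x. f x - (\<Sum>j\<in>I. c j * p j x)))"
  shows "j \<in> I \<Longrightarrow> j \<noteq> i \<Longrightarrow> \<bar>c j\<bar> \<le> N" and "\<bar>\<Sum>j\<in>I. c j\<bar> \<le> N"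
proof -
  define s where "s x = (\<Sum>j\<in>I. c j * p j x)" for x
  define g where "g = T (\<lambda>x. f x - s x)"
  have pL: "p j \<in> L1 m" and p0: "AE x in m. 0 \<le> p j x" if "j \<in> I" for j
    using p[OF that] by (auto simp: L1_densities_def)
  have p1: "(\<integral>x. p j x \<partial>m) = 1" if "j \<in> I" for j
  proof -
    have "(\<integral>x. p j x \<partial>m) = (\<integral>x. \<bar>p j x\<bar> \<partial>m)"
      by (rule integral_cong_AE) (use p0[OF that] pL[OF that] in \<open>auto simp: L1_def\<close>)
    then show ?thesis using p[OF that] by (simp add: L1_densities_def L1_norm_def)
  qed
  have fL: "f \<in> L1 m" using f by (simp add: L1_on_def)
  have sL: "s \<in> L1 m" unfolding s_def using pL by (rule L1_sum)
  have e: "(\<lambda>x. 1 * f x + (- 1) * s x) = (\<lambda>x. f x - s x)" by simp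
  have dL: "(\<lambda>x. f x - s x) \<in> L1 m" using L1_lincomb[OF fL sL, of 1 "- 1"] unfolding e .
  have gL: "integrable m g" using markov_operator_mem[OF T dL] by (simp add: g_def L1_def)
  have N: "N = (\<integral>x. \<bar>g x\<bar> \<partial>m)" by (simp add: N_def g_def s_def L1_norm_def)
  have "(\<integral>x. g x \<partial>m) = (\<integral>x. f x - s x \<partial>m)"
    unfolding g_def by (rule markov_operator_integral[OF T dL])
  also have "\<dots> = - (\<integral>x. s x \<partial>m)" using fL sL f0 by (simp add: L1_def)
  also have "(\<integral>x. s x \<partial>m) = (\<Sum>j\<in>I. c j)"
    unfolding s_def using pL p1 by (subst Bochner_Integration.integral_sum) (auto simp: L1_def)
  finally have "\<bar>\<Sum>j\<in>I. c j\<bar> = \<bar>\<integral>x. g x \<partial>m\<bar>" by simp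
  also have "\<dots> \<le> N" unfolding N by (rule integral_abs_bound)
  finally show "\<bar>\<Sum>j\<in>I. c j\<bar> \<le> N" .
  show "\<bar>c j\<bar> \<le> N" if j: "j \<in> I" "j \<noteq> i"
  proof -
    have Tp: "integrable m (T (p j))"
      using markov_operator_mem[OF T pL[OF j(1)]] by (simp add: L1_def)
    have "AE x in m. \<forall>l\<in>I. l \<noteq> j \<longrightarrow> T (p j) x = 0 \<or> T (p l) x = 0"
      using \<open>finite I\<close> disj j by (intro eventually_ball_finite) auto
    moreover have "AE x in m. g x = 1 * T f x + (- 1) * T s x"
      using markov_operator_linear[OF T fL sL, of 1 "- 1"] unfolding e g_def .
    moreover have "AE x in m. T s x = (\<Sum>l\<in>I. c l * T (p l) x)"
      unfolding s_def by (rule markov_operator_sum[OF T \<open>finite I\<close> pL])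
    ultimately have "AE x in m. \<bar>c j\<bar> * T (p j) x \<le> \<bar>g x\<bar>"
      using markov_operator_vanish[OF T pL[OF i] p0[OF i] f]
        markov_operator_nonneg[OF T pL[OF j(1)] p0[OF j(1)]]
    proof eventually_elim
      case (elim x)
      show ?case
      proof (cases "T (p j) x = 0")
        case False
        \<comment> \<open>Disjointness of the images at \<open>x\<close>: since
          \<open>j \<noteq> i\<close>, \<open>T (p i) x\<close> is 0, which kills
          \<open>T f x\<close>, and only the term \<open>j\<close> of the sum survives.\<close>
        with elim i j have "T (p i) x = 0" by metis
        with elim have "T f x = 0" by (simp add: supp_def)
        moreover have "(\<Sum>l\<in>I. c l * T (p l) x) = (\<Sum>l\<in>I. if l = j then c l * T (p l) x else 0)"
          using elim False by (intro sum.cong) auto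
        ultimately have "g x = - (c j * T (p j) x)"
          using elim \<open>finite I\<close> j by simp
        with elim show ?thesis by (simp add: abs_mult)
      qed simp
    qed
    then have "(\<integral>x. \<bar>c j\<bar> * T (p j) x \<partial>m) \<le> (\<integral>x. \<bar>g x\<bar> \<partial>m)"
      using Tp gL by (intro integral_mono_AE) auto
    then show ?thesis
      using markov_operator_integral[OF T pL[OF j(1)]] p1[OF j(1)] by (simp add: N)
  qed
qed

section \<open>Compositions along orbits, and properties valid on almost every whole orbit\<close>

subsection \<open>Iterates of the cocycle\<close>

lemma cocycle_iter_markov:
  assumes "\<And>n. markov_operator m (L1 m) (L1 m) (P ((\<sigma> ^^ n) \<omega>))"
  shows "markov_operator m (L1 m) (L1 m) (cocycle_iter P \<sigma> n \<omega>)"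
proof (induction n)
  case 0
  show ?case by (simp add: markov_operator_def)
next
  case (Suc n)
  let ?T = "P ((\<sigma> ^^ n) \<omega>)" and ?S = "cocycle_iter P \<sigma> n \<omega>"
  note T = assms[of n]
  have "AE x in m. ?T (?S (\<lambda>y. a * f y + b * g y)) x = a * ?T (?S f) x + b * ?T (?S g) x"
    if "f \<in> L1 m" "g \<in> L1 m" for f g a b
  proof -
    note S = markov_operator_mem[OF Suc]
    \<comment> \<open>The inner operator is linear only up to null sets, so the outer one must be
      known to respect equality almost everywhere.\<close>
    have "AE x in m. ?T (?S (\<lambda>y. a * f y + b * g y)) x = ?T (\<lambda>y. a * ?S f y + b * ?S g y) x"
      using markov_operator_linear[OF Suc that] that
      by (intro markov_operator_cong_AE[OF T] S L1_lincomb)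
    with markov_operator_linear[OF T S[OF that(1)] S[OF that(2)], of a b]
    show ?thesis by eventually_elim simp
  qed
  moreover have "(\<integral>x. ?T (?S f) x \<partial>m) = (\<integral>x. f x \<partial>m)" if "f \<in> L1 m" for f
    using markov_operator_integral[OF T markov_operator_mem[OF Suc that]]
      markov_operator_integral[OF Suc that] by simp
  ultimately show ?case
    using markov_operator_mem[OF Suc] markov_operator_mem[OF T]
      markov_operator_nonneg[OF Suc] markov_operator_nonneg[OF T]
    unfolding markov_operator_def by simp
qed

lemma cocycle_iter_permuted:
  assumes T: "\<And>n. markov_operator m (L1 m) (L1 m) (P ((\<sigma> ^^ n) \<omega>))"
    and \<rho>: "\<rho> permutes I"
    and \<phi>: "\<And>n i. i \<in> I \<Longrightarrow> \<phi> i ((\<sigma> ^^ n) \<omega>) \<in> L1 m"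
    and step: "\<And>n i. i \<in> I \<Longrightarrow>
      AE x in m. P ((\<sigma> ^^ n) \<omega>) (\<phi> i ((\<sigma> ^^ n) \<omega>)) x = \<phi> (\<rho> i) ((\<sigma> ^^ Suc n) \<omega>) x"
    and i: "i \<in> I"
  shows "AE x in m. cocycle_iter P \<sigma> n \<omega> (\<phi> i \<omega>) x = \<phi> ((\<rho> ^^ n) i) ((\<sigma> ^^ n) \<omega>) x"
proof (induction n)
  case (Suc n)
  have mem: "(\<rho> ^^ n) i \<in> I"
    using permutes_in_image[OF permutes_funpow[OF \<rho>]] i by auto
  have "AE x in m. P ((\<sigma> ^^ n) \<omega>) (cocycle_iter P \<sigma> n \<omega> (\<phi> i \<omega>)) x =
    P ((\<sigma> ^^ n) \<omega>) (\<phi> ((\<rho> ^^ n) i) ((\<sigma> ^^ n) \<omega>)) x"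
    using \<phi>[OF i, of 0] \<phi>[OF mem] Suc
    by (intro markov_operator_cong_AE[OF T]
        markov_operator_mem[OF cocycle_iter_markov[of m P \<sigma> \<omega>, OF T]]) auto
  with step[OF mem, of n] show ?case by eventually_elim simp
qed simp

text \<open>Preimages of null sets under \<open>\<sigma>\<close> are null, and a countable union of
  null sets covers all \<open>n\<close> at once. This turns assumptions at almost every point into
  assumptions along its orbit.\<close>

lemma AE_funpow:
  assumes \<sigma>: "measure_preserving_map Om \<sigma>" and Q: "AE \<omega> in Om. Q \<omega>"
  shows "AE \<omega> in Om. \<forall>n. Q ((\<sigma> ^^ n) \<omega>)"
proof -
  have "AE \<omega> in Om. Q ((\<sigma> ^^ n) \<omega>)" for n
  proof (induction n)
    case (Suc n)
    have "AE \<omega> in Om. Q ((\<sigma> ^^ n) (\<sigma> \<omega>))"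
    proof (rule AE_distrD[where M' = Om and f = \<sigma> and P = "\<lambda>\<omega>. Q ((\<sigma> ^^ n) \<omega>)"])
      show "\<sigma> \<in> Om \<rightarrow>\<^sub>M Om" using \<sigma> by (simp add: measure_preserving_map_def)
      show "AE \<omega> in distr Om Om \<sigma>. Q ((\<sigma> ^^ n) \<omega>)"
        using \<sigma> Suc unfolding measure_preserving_map_def by metis
    qed
    then show ?case by (simp add: funpow_swap1)
  qed (use Q in simp)
  then show ?thesis by (simp add: AE_all_countable)
qed

section \<open>Measurability and essential separability of averages of densities\<close>

subsection \<open>Convex combinations of density maps\<close>

lemma L1_norm_triangle:
  assumes "f \<in> L1 m" "g \<in> L1 m" "h \<in> L1 m"
  shows "L1_norm m (\<lambda>x. f x - h x) \<le> L1_norm m (\<lambda>x. f x - g x) + L1_norm m (\<lambda>x. g x - h x)"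
proof -
  have "L1_norm m (\<lambda>x. f x - h x) \<le> (\<integral>x. \<bar>f x - g x\<bar> + \<bar>g x - h x\<bar> \<partial>m)"
    unfolding L1_norm_def using assms by (intro integral_mono) (auto simp: L1_def)
  also have "\<dots> = L1_norm m (\<lambda>x. f x - g x) + L1_norm m (\<lambda>x. g x - h x)"
    unfolding L1_norm_def using assms by (intro Bochner_Integration.integral_add) (auto simp: L1_def)
  finally show ?thesis .
qed

lemma L1_norm_commute: "L1_norm m (\<lambda>x. f x - g x) = L1_norm m (\<lambda>x. g x - f x)"
  by (simp add: L1_norm_def abs_minus_commute)

text \<open>Convexity preserves the radius: one \<open>e\<close> serves for both components and for
  their combination.\<close>

lemma L1_norm_convex_diff:
  assumes "f \<in> L1 m" "g \<in> L1 m" "c \<in> L1 m" "d \<in> L1 m" and t: "0 \<le> t" "t \<le> 1"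
    and "L1_norm m (\<lambda>x. f x - c x) < e" "L1_norm m (\<lambda>x. g x - d x) < e"
  shows "L1_norm m (\<lambda>x. (t * f x + (1 - t) * g x) - (t * c x + (1 - t) * d x)) < e"
proof -
  have "L1_norm m (\<lambda>x. (t * f x + (1 - t) * g x) - (t * c x + (1 - t) * d x)) \<le>
      (\<integral>x. t * \<bar>f x - c x\<bar> + (1 - t) * \<bar>g x - d x\<bar> \<partial>m)"
    unfolding L1_norm_def
  proof (rule integral_mono)
    fix x
    have "(t * f x + (1 - t) * g x) - (t * c x + (1 - t) * d x) =
        t * (f x - c x) + (1 - t) * (g x - d x)"
      by (simp add: algebra_simps)
    also have "\<bar>\<dots>\<bar> \<le> \<bar>t * (f x - c x)\<bar> + \<bar>(1 - t) * (g x - d x)\<bar>" by (rule abs_triangle_ineq)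
    finally show "\<bar>(t * f x + (1 - t) * g x) - (t * c x + (1 - t) * d x)\<bar> \<le>
        t * \<bar>f x - c x\<bar> + (1 - t) * \<bar>g x - d x\<bar>"
      using t by (simp add: abs_mult)
  qed (use assms in \<open>auto simp: L1_def\<close>)
  also have "\<dots> = t * L1_norm m (\<lambda>x. f x - c x) + (1 - t) * L1_norm m (\<lambda>x. g x - d x)"
    unfolding L1_norm_def using assms
    by (subst Bochner_Integration.integral_add) (auto simp: L1_def)
  also have "\<dots> < e" using assms by (intro convex_bound_lt) auto
  finally show ?thesis .
qed

lemma L1_densities_convex:
  assumes f: "f \<in> L1_densities m" and g: "g \<in> L1_densities m" and t: "0 \<le> t" "t \<le> 1"
  shows "(\<lambda>x. t * f x + (1 - t) * g x) \<in> L1_densities m"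
proof -
  have fg: "integrable m f" "integrable m g" "AE x in m. 0 \<le> f x" "AE x in m. 0 \<le> g x"
    "(\<integral>x. \<bar>f x\<bar> \<partial>m) = 1" "(\<integral>x. \<bar>g x\<bar> \<partial>m) = 1"
    using f g by (auto simp: L1_densities_def L1_def L1_norm_def)
  have nn: "AE x in m. 0 \<le> t * f x + (1 - t) * g x"
    using fg(3,4) by eventually_elim (use t in simp)
  have "(\<integral>x. \<bar>t * f x + (1 - t) * g x\<bar> \<partial>m) = (\<integral>x. t * \<bar>f x\<bar> + (1 - t) * \<bar>g x\<bar> \<partial>m)"
  proof (rule integral_cong_AE)
    show "AE x in m. \<bar>t * f x + (1 - t) * g x\<bar> = t * \<bar>f x\<bar> + (1 - t) * \<bar>g x\<bar>"
      using fg(3,4) nn by eventually_elim simp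
  qed (use fg in auto)
  also have "\<dots> = 1"
    using fg by (subst Bochner_Integration.integral_add) auto
  finally show ?thesis
    using fg nn by (simp add: L1_densities_def L1_def L1_norm_def)
qed

lemma space_norm_borel: "space (norm_borel E N) = E"
  unfolding norm_borel_def by (rule space_measure_of) auto

lemma density_map_measurable:
  "density_map Om m f \<Longrightarrow> f \<in> Om \<rightarrow>\<^sub>M norm_borel (L1_densities m) (L1_norm m)"
  by (simp add: density_map_def bounded_measurable_def)

lemma density_map_mem: "density_map Om m f \<Longrightarrow> \<omega> \<in> space Om \<Longrightarrow> f \<omega> \<in> L1_densities m"
  using measurable_space[OF density_map_measurable] by (simp add: space_norm_borel)

text \<open>By the triangle inequality the ball is open in the set of densities, hence a generator
  of \<open>norm_borel\<close>. These preimages are the building blocks for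
  \<open>density_map_convex\<close>.\<close>

lemma density_map_ball:
  assumes f: "density_map Om m f" and c: "c \<in> L1_densities m"
  shows "{\<omega> \<in> space Om. L1_norm m (\<lambda>x. f \<omega> x - c x) < e} \<in> sets Om"
proof -
  let ?D = "L1_densities m"
  let ?U = "{u \<in> ?D. L1_norm m (\<lambda>x. u x - c x) < e}"
  have D: "?D \<subseteq> L1 m" by (auto simp: L1_densities_def)
  have "\<exists>d>0. \<forall>v\<in>?D. L1_norm m (\<lambda>x. v x - u x) < d \<longrightarrow> v \<in> ?U" if "u \<in> ?U" for u
  proof (intro exI conjI ballI impI)
    show "0 < e - L1_norm m (\<lambda>x. u x - c x)" using that by simp
    fix v assume v: "v \<in> ?D" "L1_norm m (\<lambda>x. v x - u x) < e - L1_norm m (\<lambda>x. u x - c x)"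
    moreover have "v \<in> L1 m" "u \<in> L1 m" "c \<in> L1 m" using v that c D by blast+
    ultimately show "v \<in> ?U" using L1_norm_triangle[of v m u c] by simp
  qed
  then have "?U \<in> sets (norm_borel ?D (L1_norm m))"
    unfolding norm_borel_def by (intro in_measure_of) auto
  then have "f -` ?U \<inter> space Om \<in> sets Om"
    by (rule measurable_sets[OF density_map_measurable[OF f]])
  also have "f -` ?U \<inter> space Om = {\<omega> \<in> space Om. L1_norm m (\<lambda>x. f \<omega> x - c x) < e}"
    using density_map_mem[OF f] by auto
  finally show ?thesis .
qed

text \<open>
  The preimage of an open set under the pointwise convex combination need not be measurable on the
  null set where one of the maps cannot be approximated by its countable set; there the map is
  replaced by \<open>f\<close>.
\<close>

lemma density_map_convex:
  assumes f: "density_map Om m f" and g: "density_map Om m g" and t: "0 \<le> t" "t \<le> 1"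
  shows "\<exists>h. density_map Om m h \<and> (AE \<omega> in Om. h \<omega> = (\<lambda>x. t * f \<omega> x + (1 - t) * g \<omega> x))"
proof -
  let ?D = "L1_densities m"
  let ?N = "\<lambda>u v. L1_norm m (\<lambda>x. u x - v x)"
  let ?comb = "\<lambda>u v x. t * u x + (1 - t) * v x"
  have D: "?D \<subseteq> L1 m" by (auto simp: L1_densities_def)
  obtain C where C: "countable C" "C \<subseteq> ?D" "AE \<omega> in Om. \<forall>e>0. \<exists>c\<in>C. ?N (f \<omega>) c < e"
    using f by (auto simp: density_map_def almost_separably_valued_def)
  obtain C' where C': "countable C'" "C' \<subseteq> ?D" "AE \<omega> in Om. \<forall>e>0. \<exists>c\<in>C'. ?N (g \<omega>) c < e"
    using g by (auto simp: density_map_def almost_separably_valued_def)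
  define near where "near \<omega> \<longleftrightarrow>
    (\<forall>e>0. \<exists>c\<in>C. ?N (f \<omega>) c < e) \<and> (\<forall>e>0. \<exists>c\<in>C'. ?N (g \<omega>) c < e)" for \<omega>
  have "AE \<omega> in Om. near \<omega>"
    using C(3) C'(3) by eventually_elim (simp add: near_def)
  then obtain Z where Z: "Z \<in> null_sets Om" "{\<omega> \<in> space Om. \<not> near \<omega>} \<subseteq> Z"
    by (auto simp: eventually_ae_filter)
  have good: "\<exists>c\<in>C. ?N (f \<omega>) c < e" "\<exists>c\<in>C'. ?N (g \<omega>) c < e"
    if "\<omega> \<in> space Om - Z" "e > 0" for \<omega> e
  proof -
    have "near \<omega>" using Z(2) that(1) by blast
    then show "\<exists>c\<in>C. ?N (f \<omega>) c < e" "\<exists>c\<in>C'. ?N (g \<omega>) c < e"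
      using that(2) by (simp_all add: near_def)
  qed
  define h where "h \<omega> = (if \<omega> \<in> Z then f \<omega> else ?comb (f \<omega>) (g \<omega>))" for \<omega>
  have AEZ: "AE \<omega> in Om. \<omega> \<notin> Z" using Z(1) by (rule AE_not_in)
  have hD: "h \<omega> \<in> ?D" if "\<omega> \<in> space Om" for \<omega>
    using density_map_mem[OF f that] density_map_mem[OF g that] t
    by (auto simp: h_def intro: L1_densities_convex)
  have meas: "h \<in> Om \<rightarrow>\<^sub>M norm_borel ?D (L1_norm m)"
    unfolding norm_borel_def
  proof (rule measurable_measure_of)
    fix U assume "U \<in> {U. U \<subseteq> ?D \<and> (\<forall>u\<in>U. \<exists>e>0. \<forall>v\<in>?D. ?N v u < e \<longrightarrow> v \<in> U)}"
    then have U: "U \<subseteq> ?D" "\<And>u. u \<in> U \<Longrightarrow> \<exists>e>0. \<forall>v\<in>?D. ?N v u < e \<longrightarrow> v \<in> U" by auto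
    then have "U \<in> sets (norm_borel ?D (L1_norm m))"
      unfolding norm_borel_def by (intro in_measure_of) auto
    then have fU: "f -` U \<inter> space Om \<in> sets Om"
      by (rule measurable_sets[OF density_map_measurable[OF f]])
    \<comment> \<open>\<open>Q\<close> lists the approximants \<open>c\<close>, \<open>d\<close> and
      radii for which the whole ball around their combination lies in \<open>U\<close>;
      \<open>A\<close> is where \<open>f\<close> and \<open>g\<close> are within that radius of
      \<open>c\<close> and \<open>d\<close>. The union of these countably many sets agrees with the
      preimage of \<open>U\<close> off \<open>Z\<close>.\<close>
    define Q where "Q = {(c, d, n). c \<in> C \<and> d \<in> C' \<and>
      (\<forall>v\<in>?D. ?N v (?comb c d) < inverse (real (Suc n)) \<longrightarrow> v \<in> U)}"
    define A where "A = (\<lambda>(c, d, n). {\<omega> \<in> space Om. ?N (f \<omega>) c < inverse (real (Suc n))} \<inter>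
      {\<omega> \<in> space Om. ?N (g \<omega>) d < inverse (real (Suc n))})"
    have "Q \<subseteq> C \<times> C' \<times> UNIV" by (auto simp: Q_def)
    then have "countable Q" using C(1) C'(1) by (meson countable_SIGMA countableI_type countable_subset)
    moreover have "A q \<in> sets Om" if "q \<in> Q" for q
      using that C(2) C'(2) unfolding A_def Q_def
      by (auto intro!: sets.Int density_map_ball[OF f] density_map_ball[OF g])
    ultimately have AQ: "(\<Union>q\<in>Q. A q) \<in> sets Om" by (intro sets.countable_UN') auto
    have AU: "\<omega> \<in> (\<Union>q\<in>Q. A q) \<longleftrightarrow> h \<omega> \<in> U" if \<omega>: "\<omega> \<in> space Om - Z" for \<omega>
    proof
      have fg: "f \<omega> \<in> L1 m" "g \<omega> \<in> L1 m" "h \<omega> \<in> ?D"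
        and h: "h \<omega> = ?comb (f \<omega>) (g \<omega>)"
        using \<omega> density_map_mem[OF f, of \<omega>] density_map_mem[OF g, of \<omega>] D hD[of \<omega>]
        by (auto simp: h_def)
      {
        assume "\<omega> \<in> (\<Union>q\<in>Q. A q)"
        then obtain c d n where q: "c \<in> C" "d \<in> C'"
          "\<forall>v\<in>?D. ?N v (?comb c d) < inverse (real (Suc n)) \<longrightarrow> v \<in> U"
          "?N (f \<omega>) c < inverse (real (Suc n))" "?N (g \<omega>) d < inverse (real (Suc n))"
          unfolding Q_def A_def by auto
        have "?N (h \<omega>) (?comb c d) < inverse (real (Suc n))"
          unfolding h using q fg t C(2) C'(2) D by (intro L1_norm_convex_diff) auto
        with q(3) fg show "h \<omega> \<in> U" by blast
      next
        assume "h \<omega> \<in> U"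
        then obtain e where e: "e > 0" "\<forall>v\<in>?D. ?N v (h \<omega>) < e \<longrightarrow> v \<in> U" using U(2) by blast
        \<comment> \<open>Half of \<open>e\<close>, because \<open>v\<close> and
          \<open>h \<omega>\<close> each lie within this radius of the combination of
          \<open>c\<close> and \<open>d\<close>.\<close>
        then obtain n where n: "inverse (real (Suc n)) < e / 2"
          using reals_Archimedean[of "e / 2"] by auto
        obtain c d where cd: "c \<in> C" "d \<in> C'"
          "?N (f \<omega>) c < inverse (real (Suc n))" "?N (g \<omega>) d < inverse (real (Suc n))"
          using good[OF \<omega>, of "inverse (real (Suc n))"] by auto
        have cdL: "c \<in> L1 m" "d \<in> L1 m" using cd C(2) C'(2) D by auto
        have close: "?N (h \<omega>) (?comb c d) < inverse (real (Suc n))"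
          unfolding h using cd cdL fg t by (intro L1_norm_convex_diff) auto
        have "v \<in> U" if v: "v \<in> ?D" "?N v (?comb c d) < inverse (real (Suc n))" for v
        proof -
          have "?N v (h \<omega>) \<le> ?N v (?comb c d) + ?N (?comb c d) (h \<omega>)"
            using v fg D cdL by (intro L1_norm_triangle L1_lincomb) auto
          also have "?N (?comb c d) (h \<omega>) = ?N (h \<omega>) (?comb c d)" by (rule L1_norm_commute)
          finally show ?thesis using e(2) v close n by auto
        qed
        then have "(c, d, n) \<in> Q" "\<omega> \<in> A (c, d, n)" using cd \<omega> by (auto simp: Q_def A_def)
        then show "\<omega> \<in> (\<Union>q\<in>Q. A q)" by blast
      }
    qed
    have "(\<Union>q\<in>Q. A q) \<subseteq> space Om" by (auto simp: A_def)
    then have hU: "h -` U \<inter> (space Om - Z) = (\<Union>q\<in>Q. A q) - Z"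
      using AU by blast
    \<comment> \<open>\<open>Om\<close> is not assumed complete, so a subset of the null set
      \<open>Z\<close> could fail to be measurable. On \<open>Z\<close> the map \<open>h\<close> is
      \<open>f\<close>, whose preimages are measurable.\<close>
    have hUZ: "h -` U \<inter> (space Om \<inter> Z) = f -` U \<inter> space Om \<inter> Z" by (auto simp: h_def)
    have "h -` U \<inter> space Om = (h -` U \<inter> (space Om \<inter> Z)) \<union> (h -` U \<inter> (space Om - Z))" by auto
    also have "\<dots> = (f -` U \<inter> space Om \<inter> Z) \<union> ((\<Union>q\<in>Q. A q) - Z)" unfolding hU hUZ ..
    also have "\<dots> \<in> sets Om" using fU AQ Z(1) by auto
    finally show "h -` U \<inter> space Om \<in> sets Om" .
  qed (use hD in auto)
  have "almost_separably_valued Om ?D (L1_norm m) h"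
    unfolding almost_separably_valued_def
  proof (intro exI conjI)
    let ?C = "(\<lambda>(c, d). ?comb c d) ` (C \<times> C')"
    show "countable ?C" using C(1) C'(1) by auto
    show "?C \<subseteq> ?D" using C(2) C'(2) t by (auto intro!: L1_densities_convex)
    show "AE \<omega> in Om. \<forall>e>0. \<exists>c\<in>?C. ?N (h \<omega>) c < e"
      using AEZ AE_space
    proof eventually_elim
      case (elim \<omega>)
      show ?case
      proof (intro allI impI)
        fix e :: real assume "e > 0"
        then obtain c d where cd: "c \<in> C" "d \<in> C'" "?N (f \<omega>) c < e" "?N (g \<omega>) d < e"
          using good[of \<omega> e] elim by auto
        have "f \<omega> \<in> L1 m" "g \<omega> \<in> L1 m" "c \<in> L1 m" "d \<in> L1 m"
          using cd elim density_map_mem[OF f] density_map_mem[OF g] C(2) C'(2) D by auto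
        then have "?N (?comb (f \<omega>) (g \<omega>)) (?comb c d) < e"
          using cd t by (intro L1_norm_convex_diff) auto
        with cd elim show "\<exists>c\<in>?C. ?N (h \<omega>) c < e" by (auto simp: h_def)
      qed
    qed
  qed
  moreover have "\<forall>\<omega>\<in>space Om. L1_norm m (h \<omega>) \<le> 1"
    using hD by (auto simp: L1_densities_def)
  ultimately have "density_map Om m h"
    using meas by (auto simp: density_map_def bounded_measurable_def)
  moreover have "AE \<omega> in Om. h \<omega> = ?comb (f \<omega>) (g \<omega>)"
    using AEZ by eventually_elim (simp add: h_def)
  ultimately show ?thesis by blast
qed

text \<open>Adjoining one map at a time keeps every stage a convex combination of two density maps.
  Equality holds only almost everywhere, since each stage may alter the map on a null set.\<close>

lemma density_map_average:
  assumes "\<And>i. i \<in> {1..r} \<Longrightarrow> density_map Om m (\<phi> i)" and "1 \<le> r"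
  shows "\<exists>h. density_map Om m h \<and>
    (AE \<omega> in Om. h \<omega> = (\<lambda>x. \<Sum>i=1..r. (1 / real r) * \<phi> i \<omega> x))"
  using assms(2,1)
proof (induction r rule: dec_induct)
  case base
  then show ?case by (intro exI[of _ "\<phi> 1"]) simp
next
  case (step n)
  then obtain h where h: "density_map Om m h"
    "AE \<omega> in Om. h \<omega> = (\<lambda>x. \<Sum>i=1..n. (1 / real n) * \<phi> i \<omega> x)"
    by auto
  \<comment> \<open>The weights \<open>n / (n + 1)\<close> and \<open>1 / (n + 1)\<close> turn the
    mean of \<open>n\<close> maps into the mean of \<open>n + 1\<close>.\<close>
  define t where "t = real n / real (Suc n)"
  have t: "0 \<le> t" "t \<le> 1" by (auto simp: t_def)
  obtain h' where h': "density_map Om m h'"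
    "AE \<omega> in Om. h' \<omega> = (\<lambda>x. t * h \<omega> x + (1 - t) * \<phi> (Suc n) \<omega> x)"
    using density_map_convex[OF h(1) step.prems t] by auto
  have c: "t * (1 / real n) = 1 / real (Suc n)" "1 - t = 1 / real (Suc n)"
    using step.hyps by (auto simp: t_def field_simps)
  have "AE \<omega> in Om. h' \<omega> = (\<lambda>x. \<Sum>i=1..Suc n. (1 / real (Suc n)) * \<phi> i \<omega> x)"
    using h(2) h'(2)
  proof eventually_elim
    case (elim \<omega>)
    show ?case
      unfolding elim(2) elim(1) sum_distrib_left mult.assoc[symmetric] c by simp
  qed
  with h'(1) show ?case by blast
qed

subsection \<open>Asymptotically periodic cocycles\<close>

theorem proposition4p6:
  fixes m :: "'x measure" and Om :: "'w measure"
    and \<sigma> :: "'w \<Rightarrow> 'w"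
    and P :: "'w \<Rightarrow> ('x \<Rightarrow> real) \<Rightarrow> 'x \<Rightarrow> real"
    and r :: nat
    and lam :: "nat \<Rightarrow> 'w \<Rightarrow> ('x \<Rightarrow> real) \<Rightarrow> real"
    and \<phi> :: "nat \<Rightarrow> 'w \<Rightarrow> 'x \<Rightarrow> real"
    and \<rho> :: "'w \<Rightarrow> nat \<Rightarrow> nat"
    and \<rho>0 :: "nat \<Rightarrow> nat"
  assumes "prob_space m" and "prob_space Om"
    and "measure_preserving_map Om \<sigma>"
    and "markov_cocycle Om m P"
    and "asymptotically_periodic Om m \<sigma> P r lam \<phi> \<rho>"
    and "AE \<omega> in Om. \<rho> \<omega> = \<rho>0"
  shows "(\<exists>h. invariant_density_map Om m \<sigma> P h) \<and>
         (\<exists>k\<ge>1. \<forall>i\<in>{1..r}. restriction_exact Om m \<sigma> P k (\<phi> i))"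
proof -
  let ?I = "{1..r}"
  have r: "1 \<le> r" and dens: "\<And>i. i \<in> ?I \<Longrightarrow> density_map Om m (\<phi> i)"
    using assms(5) by (auto simp: asymptotically_periodic_def)
  \<comment> \<open>All pointwise requirements at \<open>\<omega>\<close>, with the constant
    \<open>\<rho>0\<close> in place of \<open>\<rho> \<omega>\<close>.\<close>
  define good where "good \<omega> \<longleftrightarrow>
      \<omega> \<in> space Om \<and> markov_operator m (L1 m) (L1 m) (P \<omega>) \<and>
      (\<forall>i\<in>?I. \<forall>j\<in>?I. i \<noteq> j \<longrightarrow> (AE x in m. x \<notin> supp m (\<phi> i \<omega>) \<inter> supp m (\<phi> j \<omega>))) \<and>
      (\<forall>i\<in>?I. AE x in m. P \<omega> (\<phi> i \<omega>) x = \<phi> (\<rho>0 i) (\<sigma> \<omega>) x) \<and>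
      (\<forall>f\<in>L1 m. (\<lambda>n. L1_norm m (cocycle_iter P \<sigma> n \<omega>
        (\<lambda>x. f x - (\<Sum>i=1..r. lam i \<omega> f * \<phi> i \<omega> x)))) \<longlonglongrightarrow> 0)" for \<omega>
  have "AE \<omega> in Om. markov_operator m (L1 m) (L1 m) (P \<omega>)"
    using assms(4) by (simp add: markov_cocycle_def)
  moreover note assms(5)[unfolded asymptotically_periodic_def, THEN conjunct2, THEN conjunct2, THEN conjunct2]
  ultimately have AP: "AE \<omega> in Om. \<rho>0 permutes ?I \<and> good \<omega>"
    using assms(6) AE_space unfolding good_def by eventually_elim simp
  \<comment> \<open>The assertion does not depend on \<open>\<omega>\<close>, so on a probability
    space holding almost everywhere means holding.\<close>
  then have \<rho>: "\<rho>0 permutes ?I"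
    using prob_space.AE_const[OF assms(2)] by (auto elim: eventually_mono)
  have orbit: "AE \<omega> in Om. \<forall>n. good ((\<sigma> ^^ n) \<omega>)"
    by (rule AE_funpow[OF assms(3)]) (use AP in eventually_elim, simp)
  have phi: "\<phi> i \<omega> \<in> L1_densities m" if "i \<in> ?I" "good \<omega>" for i \<omega>
    using density_map_mem[OF dens] that by (auto simp: good_def)
  then have phiL: "\<phi> i \<omega> \<in> L1 m" and phi0: "AE x in m. 0 \<le> \<phi> i \<omega> x" if "i \<in> ?I" "good \<omega>" for i \<omega>
    using that by (auto simp: L1_densities_def)

  \<comment> \<open>The invariant density map\<close>
  obtain h where h: "density_map Om m h"
    "AE \<omega> in Om. h \<omega> = (\<lambda>x. \<Sum>i=1..r. (1 / real r) * \<phi> i \<omega> x)"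
    using density_map_average[of r Om m \<phi>, OF dens r] by blast
  have "AE \<omega> in Om. AE x in m. P \<omega> (h \<omega>) x = h (\<sigma> \<omega>) x"
    \<comment> \<open>\<open>h\<close> is the average only off a null set, and both \<omega> and its
      image under \<sigma> have to avoid that set.\<close>
    using AE_funpow[OF assms(3) h(2)] orbit
  proof eventually_elim
    case (elim \<omega>)
    have g: "good \<omega>" using elim(2)[rule_format, of 0] by simp
    have hw: "h \<omega> = (\<lambda>x. \<Sum>i=1..r. (1 / real r) * \<phi> i \<omega> x)"
      and hs: "h (\<sigma> \<omega>) = (\<lambda>x. \<Sum>i=1..r. (1 / real r) * \<phi> i (\<sigma> \<omega>) x)"
      using elim(1)[rule_format, of 0] elim(1)[rule_format, of 1] by simp_all
    have "AE x in m. P \<omega> (h \<omega>) x = (\<Sum>i=1..r. (1 / real r) * P \<omega> (\<phi> i \<omega>) x)"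
      unfolding hw using g phiL[OF _ g] by (intro markov_operator_sum) (auto simp: good_def)
    moreover have "AE x in m. \<forall>i\<in>?I. P \<omega> (\<phi> i \<omega>) x = \<phi> (\<rho>0 i) (\<sigma> \<omega>) x"
      using g by (intro eventually_ball_finite) (auto simp: good_def)
    ultimately show ?case
    proof eventually_elim
      case (elim x)
      then have "P \<omega> (h \<omega>) x = (\<Sum>i=1..r. (1 / real r) * \<phi> (\<rho>0 i) (\<sigma> \<omega>) x)" by simp
      also have "\<dots> = h (\<sigma> \<omega>) x"
        \<comment> \<open>All weights are equal, so reindexing by \<open>\<rho>0\<close> leaves the
          average unchanged.\<close>
        unfolding hs using sum.permute[OF \<rho>, of "\<lambda>i. (1 / real r) * \<phi> i (\<sigma> \<omega>) x"]
        by (simp add: o_def)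
      finally show ?case .
    qed
  qed
  with h(1) have inv: "\<exists>h. invariant_density_map Om m \<sigma> P h"
    by (auto simp: invariant_density_map_def)

  \<comment> \<open>Exactness on the supports\<close>
  have "permutation \<rho>0" using \<rho> by (auto simp: permutation_permutes)
  \<comment> \<open>A permutation of a finite set has finite order. Positivity of \<open>k\<close>
    makes \<open>n * k\<close> tend to infinity, so the times \<open>n * k\<close> inherit the
    limit.\<close>
  then obtain k where k: "\<rho>0 ^^ k = id" "k > 0" using permutation_is_nilpotent by blast
  have iter: "markov_operator m (L1 m) (L1 m) (cocycle_iter P \<sigma> n \<omega>)"
    "AE x in m. cocycle_iter P \<sigma> (n * k) \<omega> (\<phi> i \<omega>) x = \<phi> i ((\<sigma> ^^ (n * k)) \<omega>) x"
    if g: "\<forall>n. good ((\<sigma> ^^ n) \<omega>)" and i: "i \<in> ?I" for n i \<omega>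
  proof -
    have T: "markov_operator m (L1 m) (L1 m) (P ((\<sigma> ^^ n) \<omega>))" for n
      using g by (simp add: good_def)
    show "markov_operator m (L1 m) (L1 m) (cocycle_iter P \<sigma> n \<omega>)"
      by (rule cocycle_iter_markov) (rule T)
    have "\<rho>0 ^^ (n * k) = id"
      by (simp add: mult.commute[of n] funpow_mult[symmetric] k)
    moreover have "AE x in m. cocycle_iter P \<sigma> (n * k) \<omega> (\<phi> i \<omega>) x =
        \<phi> ((\<rho>0 ^^ (n * k)) i) ((\<sigma> ^^ (n * k)) \<omega>) x"
      using g i
      by (intro cocycle_iter_permuted[where P = P and \<sigma> = \<sigma> and \<omega> = \<omega>, OF T \<rho>])
        (auto simp: phiL good_def)
    ultimately show "AE x in m. cocycle_iter P \<sigma> (n * k) \<omega> (\<phi> i \<omega>) x = \<phi> i ((\<sigma> ^^ (n * k)) \<omega>) x"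
      by simp
  qed
  have "restriction_exact Om m \<sigma> P k (\<phi> i)" if i: "i \<in> ?I" for i
    unfolding restriction_exact_def
  proof
    show "AE \<omega> in Om. markov_operator m (L1_on m (supp m (\<phi> i \<omega>)))
        (L1_on m (supp m (\<phi> i ((\<sigma> ^^ k) \<omega>)))) (cocycle_iter P \<sigma> k \<omega>)"
      using orbit
    proof eventually_elim
      case (elim \<omega>)
      have "good \<omega>" using elim[rule_format, of 0] by simp
      with iter(1)[OF elim i] iter(2)[OF elim i, of 1] i show ?case
        by (intro markov_operator_restrict phiL phi0) auto
    qed
    show "AE \<omega> in Om. \<forall>f\<in>L1_on m (supp m (\<phi> i \<omega>)). (\<integral>x. f x \<partial>m) = 0 \<longrightarrow>
        (\<lambda>n. L1_norm m (cocycle_iter P \<sigma> (n * k) \<omega> f)) \<longlonglongrightarrow> 0"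
      using orbit
    proof eventually_elim
      case (elim \<omega>)
      have g: "good \<omega>" using elim[rule_format, of 0] by simp
      show ?case
      proof (intro ballI impI)
        fix f assume f: "f \<in> L1_on m (supp m (\<phi> i \<omega>))" "(\<integral>x. f x \<partial>m) = 0"
        let ?T = "\<lambda>n. cocycle_iter P \<sigma> (n * k) \<omega>"
        let ?c = "\<lambda>j. lam j \<omega> f"
        let ?N = "\<lambda>n. L1_norm m (?T n (\<lambda>x. f x - (\<Sum>j=1..r. ?c j * \<phi> j \<omega> x)))"
        have "(\<lambda>n. L1_norm m (cocycle_iter P \<sigma> n \<omega>
            (\<lambda>x. f x - (\<Sum>j=1..r. ?c j * \<phi> j \<omega> x)))) \<longlonglongrightarrow> 0"
          using g f(1) by (auto simp: good_def L1_on_def)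
        moreover have "filterlim (\<lambda>n. n * k) sequentially sequentially"
          using k(2) by (intro filterlim_at_top_mono[OF filterlim_ident]) auto
        ultimately have lim: "?N \<longlonglongrightarrow> 0"
          by (rule filterlim_compose)
        \<comment> \<open>By \<open>iter(2)\<close> the images are the densities at the point
          reached after \<open>n * k\<close> steps, which is again good.\<close>
        have disj: "AE x in m. ?T n (\<phi> j \<omega>) x = 0 \<or> ?T n (\<phi> l \<omega>) x = 0"
          if jl: "j \<in> ?I" "l \<in> ?I" "j \<noteq> l" for j l n
        proof -
          let ?\<omega> = "(\<sigma> ^^ (n * k)) \<omega>"
          have "AE x in m. x \<notin> supp m (\<phi> j ?\<omega>) \<inter> supp m (\<phi> l ?\<omega>)"
            using elim jl by (auto simp: good_def)
          then show ?thesis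
            using iter(2)[OF elim jl(1), of n] iter(2)[OF elim jl(2), of n] AE_space
            by eventually_elim (auto simp: supp_def)
        qed
        note bounds = markov_operator_coeff_bounds[where m = m and I = ?I
            and p = "\<lambda>j. \<phi> j \<omega>" and i = i and f = f and c = ?c]
        have sum_bound: "\<bar>\<Sum>j\<in>?I. ?c j\<bar> \<le> ?N n" for n
          by (rule bounds(2)) (use iter(1)[OF elim i] phi[OF _ g] disj i f in simp_all)
        have c0: "?c j = 0" if j: "j \<in> ?I" "j \<noteq> i" for j
        proof -
          \<comment> \<open>The left side does not depend on \<open>n\<close>, while the bounds
            \<open>?N n\<close> tend to 0.\<close>
          have "\<bar>?c j\<bar> \<le> 0"
          proof (intro LIMSEQ_le_const[OF lim] exI allI impI)
            fix n show "\<bar>?c j\<bar> \<le> ?N n"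
              by (rule bounds(1)) (use iter(1)[OF elim i] phi[OF _ g] disj i f j in simp_all)
          qed
          then show ?thesis by simp
        qed
        have "\<bar>\<Sum>j\<in>?I. ?c j\<bar> \<le> 0"
          using sum_bound by (intro LIMSEQ_le_const[OF lim]) auto
        \<comment> \<open>Only the coefficient at \<open>i\<close> is left in the sum, so the bound
          on the sum forces it to vanish too.\<close>
        moreover have "(\<Sum>j\<in>?I. ?c j) = (\<Sum>j\<in>?I. if j = i then ?c j else 0)"
          using c0 by (intro sum.cong) auto
        ultimately have "?c j = 0" if "j \<in> ?I" for j
          using c0 i that by (cases "j = i") auto
        then have "(\<lambda>x. f x - (\<Sum>j=1..r. ?c j * \<phi> j \<omega> x)) = f" by simp
        with lim show "(\<lambda>n. L1_norm m (?T n f)) \<longlonglongrightarrow> 0" by simp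
      qed
    qed
  qed
  with k(2) have "\<exists>k\<ge>1. \<forall>i\<in>?I. restriction_exact Om m \<sigma> P k (\<phi> i)"
    by (intro exI[of _ k]) auto
  with inv show ?thesis by blast
qed

end
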